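(* There exist division rings $D\subseteq D'$ and a valuation $v$ on $D$ which extends to a valuation $v'$ on $D'$ such that $D'$ is an extension of $D$ by limits of pseudo-Cauchy sequences in $D$, whereas $v'$ is not an immediate extension of $v$.
   Context: A valuation on a division ring $D$ is a map $v:D\to\Gamma\cup\{\infty\}$, with $\Gamma$ an additively written totally ordered group and $\infty>\gamma$ for all $\gamma\in\Gamma$, such that $v(a)=\infty\iff a=0$, $v(ab)=v(a)+v(b)$ and $v(a+b)\ge\min\{v(a),v(b)\}$. A pseudo-Cauchy sequence in $(D,v)$ is a sequence $(a_\lambda)_{\lambda\in\Lambda}\subseteq D$, with $\Lambda$ an ordinal, for which there is $\lambda\in\Lambda$ such that $v(a_\sigma-a_\rho)<v(a_\rho-a_\tau)$ for all $\sigma,\rho,\tau\in\Lambda$ with $\lambda\le\sigma<\rho<\tau$. If $D'\supseteq D$ is a division ring and $v'$ a valuation on $D'$ extending $v$, then $a\in D'$ is a limit of $(a_\lambda)_{\lambda\in\Lambda}$ if $v'(a-a_\sigma)=v'(a_{\sigma+1}-a_\sigma)$ for all $\sigma\in\Lambda$ with $\lambda\le\sigma$. $D'$ is an extension of $D$ by limits of pseudo-Cauchy sequences in $D$ if $D'$ is generated, as a division ring, by $D$ together with elements of $D'$ that are limits of pseudo-Cauchy sequences in $D$. The extension $v'$ of $v$ is immediate if $v$ and $v'$ have the same value group and the same residue division ring. *)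

theory Defs
  imports "HOL-Algebra.QuotRing" "HOL-Algebra.Subrings" "HOL.Hull"
begin

locale div_ring = ring +
  assumes one_not_zero: "\<one> \<noteq> \<zero>"
    and Units_eq: "Units R = carrier R - {\<zero>}"

definition sub_div_ring :: "'a set \<Rightarrow> ('a, 'm) ring_scheme \<Rightarrow> bool"
  where "sub_div_ring K R \<longleftrightarrow> subring K R \<and> div_ring (R\<lparr>carrier := K\<rparr>)"

definition div_ring_generated :: "('a, 'm) ring_scheme \<Rightarrow> 'a set \<Rightarrow> 'a set"
  where "div_ring_generated R S = (\<lambda>K. sub_div_ring K R) hull S"


text \<open>
  Value groups need not be abelian. They are group records of the algebra library, so their
  operation is written multiplicatively here: the sum of two values is
  \<open>\<otimes>\<close> and the value 0 is \<open>\<one>\<close>. Only the restriction of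
  \<open>gle\<close> to the carrier is relevant.
\<close>

record 'g ordered_group = "'g monoid" +
  gle :: "'g \<Rightarrow> 'g \<Rightarrow> bool" (infixl \<open>\<preceq>\<index>\<close> 50)

locale ordered_group = group G for G :: "('g, 'm) ordered_group_scheme" (structure) +
  assumes linear_order:
      "linear_order_on (carrier G) {(x, y). x \<in> carrier G \<and> y \<in> carrier G \<and> x \<preceq> y}"
    and translation_left:
      "\<lbrakk>x \<in> carrier G; y \<in> carrier G; z \<in> carrier G; x \<preceq> y\<rbrakk> \<Longrightarrow> z \<otimes> x \<preceq> z \<otimes> y"
    and translation_right:
      "\<lbrakk>x \<in> carrier G; y \<in> carrier G; z \<in> carrier G; x \<preceq> y\<rbrakk> \<Longrightarrow> x \<otimes> z \<preceq> y \<otimes> z"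

definition ordered_subgroup ::
    "('g, 'm) ordered_group_scheme \<Rightarrow> ('g, 'm) ordered_group_scheme \<Rightarrow> bool"
  where "ordered_subgroup H G \<longleftrightarrow> subgroup (carrier H) G \<and> H = G\<lparr>carrier := carrier H\<rparr>"

datatype 'g with_infinity = Val 'g | Infinity

fun val_plus ::
    "('g, 'm) ordered_group_scheme \<Rightarrow> 'g with_infinity \<Rightarrow> 'g with_infinity \<Rightarrow> 'g with_infinity"
  where
    "val_plus G (Val x) (Val y) = Val (x \<otimes>\<^bsub>G\<^esub> y)"
  | "val_plus G Infinity b = Infinity"
  | "val_plus G a Infinity = Infinity"

fun val_le :: "('g, 'm) ordered_group_scheme \<Rightarrow> 'g with_infinity \<Rightarrow> 'g with_infinity \<Rightarrow> bool"
  where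
    "val_le G a Infinity \<longleftrightarrow> True"
  | "val_le G Infinity (Val y) \<longleftrightarrow> False"
  | "val_le G (Val x) (Val y) \<longleftrightarrow> x \<preceq>\<^bsub>G\<^esub> y"

definition val_less :: "('g, 'm) ordered_group_scheme \<Rightarrow> 'g with_infinity \<Rightarrow> 'g with_infinity \<Rightarrow> bool"
  where "val_less G a b \<longleftrightarrow> val_le G a b \<and> a \<noteq> b"

definition val_min ::
    "('g, 'm) ordered_group_scheme \<Rightarrow> 'g with_infinity \<Rightarrow> 'g with_infinity \<Rightarrow> 'g with_infinity"
  where "val_min G a b = (if val_le G a b then a else b)"


locale valuation = R: div_ring R + G: ordered_group G
  for R :: "('a, 'm) ring_scheme" and G :: "('g, 'n) ordered_group_scheme"
    and v :: "'a \<Rightarrow> 'g with_infinity" +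
  assumes val_in: "a \<in> carrier R \<Longrightarrow> v a \<in> insert Infinity (Val ` carrier G)"
    and val_Infinity_iff: "a \<in> carrier R \<Longrightarrow> v a = Infinity \<longleftrightarrow> a = \<zero>\<^bsub>R\<^esub>"
    and val_mult:
      "\<lbrakk>a \<in> carrier R; b \<in> carrier R\<rbrakk> \<Longrightarrow> v (a \<otimes>\<^bsub>R\<^esub> b) = val_plus G (v a) (v b)"
    and val_add:
      "\<lbrakk>a \<in> carrier R; b \<in> carrier R\<rbrakk> \<Longrightarrow> val_le G (val_min G (v a) (v b)) (v (a \<oplus>\<^bsub>R\<^esub> b))"

definition value_group ::
    "('a, 'm) ring_scheme \<Rightarrow> ('g, 'n) ordered_group_scheme \<Rightarrow> ('a \<Rightarrow> 'g with_infinity) \<Rightarrow> 'g set"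
  where "value_group R G v = {g \<in> carrier G. \<exists>a\<in>carrier R. v a = Val g}"

definition valuation_ring ::
    "('a, 'm) ring_scheme \<Rightarrow> ('g, 'n) ordered_group_scheme \<Rightarrow> ('a \<Rightarrow> 'g with_infinity) \<Rightarrow> 'a set"
  where "valuation_ring R G v = {a \<in> carrier R. val_le G (Val \<one>\<^bsub>G\<^esub>) (v a)}"

definition valuation_ideal ::
    "('a, 'm) ring_scheme \<Rightarrow> ('g, 'n) ordered_group_scheme \<Rightarrow> ('a \<Rightarrow> 'g with_infinity) \<Rightarrow> 'a set"
  where "valuation_ideal R G v = {a \<in> carrier R. val_less G (Val \<one>\<^bsub>G\<^esub>) (v a)}"

definition residue_division_ring ::
    "('a, 'm) ring_scheme \<Rightarrow> ('g, 'n) ordered_group_scheme \<Rightarrow> ('a \<Rightarrow> 'g with_infinity) \<Rightarrow> 'a set ring"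
  where "residue_division_ring R G v =
    (R\<lparr>carrier := valuation_ring R G v\<rparr>) Quot valuation_ideal R G v"

definition valuation_extension ::
    "('a, 'm) ring_scheme \<Rightarrow> ('g, 'n) ordered_group_scheme \<Rightarrow> ('a \<Rightarrow> 'g with_infinity) \<Rightarrow>
     ('a, 'm) ring_scheme \<Rightarrow> ('g, 'n) ordered_group_scheme \<Rightarrow> ('a \<Rightarrow> 'g with_infinity) \<Rightarrow> bool"
  where "valuation_extension D G v D' G' v' \<longleftrightarrow>
    valuation D G v \<and> valuation D' G' v' \<and>
    sub_div_ring (carrier D) D' \<and> D = D'\<lparr>carrier := carrier D\<rparr> \<and>
    ordered_subgroup G G' \<and>
    (\<forall>a\<in>carrier D. v' a = v a)"

text \<open>
  The residue division rings are compared along the canonical map, which sends the coset of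
  \<open>a\<close> modulo the ideal \<open>M\<close> of \<open>v\<close> to the coset of \<open>a\<close> modulo the ideal \<open>M'\<close> of
  \<open>v'\<close>; as \<open>M \<subseteq> M'\<close>, the latter is \<open>M' + X\<close> where \<open>X\<close> is the former.
\<close>

definition immediate_extension ::
    "('a, 'm) ring_scheme \<Rightarrow> ('g, 'n) ordered_group_scheme \<Rightarrow> ('a \<Rightarrow> 'g with_infinity) \<Rightarrow>
     ('a, 'm) ring_scheme \<Rightarrow> ('g, 'n) ordered_group_scheme \<Rightarrow> ('a \<Rightarrow> 'g with_infinity) \<Rightarrow> bool"
  where "immediate_extension D G v D' G' v' \<longleftrightarrow>
    valuation_extension D G v D' G' v' \<and>
    value_group D G v = value_group D' G' v' \<and>
    (\<lambda>X. valuation_ideal D' G' v' <+>\<^bsub>D'\<^esub> X)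
      \<in> ring_iso (residue_division_ring D G v) (residue_division_ring D' G' v')"


text \<open>
  An ordinal is represented by a well-order \<open>r\<close> on its field. It has to be a nonzero limit
  ordinal: the definition of a limit of a sequence refers to \<open>\<sigma> + 1\<close> for arbitrarily
  large \<open>\<sigma>\<close>, and on an ordinal with a last element every sequence would be pseudo-Cauchy.
\<close>

definition limit_ordinal :: "'i rel \<Rightarrow> bool"
  where "limit_ordinal r \<longleftrightarrow>
    Well_order r \<and> Field r \<noteq> {} \<and> (\<forall>\<sigma>\<in>Field r. \<exists>\<rho>\<in>Field r. (\<sigma>, \<rho>) \<in> r - Id)"

definition pseudo_Cauchy_from ::
    "('a, 'm) ring_scheme \<Rightarrow> ('g, 'n) ordered_group_scheme \<Rightarrow> ('a \<Rightarrow> 'g with_infinity) \<Rightarrow>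
     'i rel \<Rightarrow> ('i \<Rightarrow> 'a) \<Rightarrow> 'i \<Rightarrow> bool"
  where "pseudo_Cauchy_from D G v r s \<kappa> \<longleftrightarrow>
    limit_ordinal r \<and> s ` Field r \<subseteq> carrier D \<and> \<kappa> \<in> Field r \<and>
    (\<forall>\<sigma> \<rho> \<tau>. (\<kappa>, \<sigma>) \<in> r \<and> (\<sigma>, \<rho>) \<in> r - Id \<and> (\<rho>, \<tau>) \<in> r - Id \<longrightarrow>
       val_less G (v (s \<sigma> \<ominus>\<^bsub>D\<^esub> s \<rho>)) (v (s \<rho> \<ominus>\<^bsub>D\<^esub> s \<tau>)))"

definition limit_from ::
    "('a, 'm) ring_scheme \<Rightarrow> ('a \<Rightarrow> 'g with_infinity) \<Rightarrow> 'i rel \<Rightarrow> ('i \<Rightarrow> 'a) \<Rightarrow> 'i \<Rightarrow> 'a \<Rightarrow> bool"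
  where "limit_from D' v' r s \<kappa> a \<longleftrightarrow>
    a \<in> carrier D' \<and>
    (\<forall>\<sigma>. (\<kappa>, \<sigma>) \<in> r \<longrightarrow>
       v' (a \<ominus>\<^bsub>D'\<^esub> s \<sigma>) = v' (s (wo_rel.suc r {\<sigma>}) \<ominus>\<^bsub>D'\<^esub> s \<sigma>))"

text \<open>
  Well-orders on subsets of the type \<open>'a\<close> of ring elements suffice as index sets: a
  pseudo-Cauchy sequence is injective from \<open>\<kappa>\<close> on, and passing to this tail changes
  neither the pseudo-Cauchy property nor the limits.
\<close>

definition pseudo_Cauchy_limits ::
    "('a, 'm) ring_scheme \<Rightarrow> ('g, 'n) ordered_group_scheme \<Rightarrow> ('a \<Rightarrow> 'g with_infinity) \<Rightarrow>
     ('a, 'm) ring_scheme \<Rightarrow> ('a \<Rightarrow> 'g with_infinity) \<Rightarrow> 'a set"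
  where "pseudo_Cauchy_limits D G v D' v' =
    {a. \<exists>(r :: 'a rel) s \<kappa>. pseudo_Cauchy_from D G v r s \<kappa> \<and> limit_from D' v' r s \<kappa> a}"

definition extension_by_limits ::
    "('a, 'm) ring_scheme \<Rightarrow> ('g, 'n) ordered_group_scheme \<Rightarrow> ('a \<Rightarrow> 'g with_infinity) \<Rightarrow>
     ('a, 'm) ring_scheme \<Rightarrow> ('a \<Rightarrow> 'g with_infinity) \<Rightarrow> bool"
  where "extension_by_limits D G v D' v' \<longleftrightarrow>
    carrier D' = div_ring_generated D' (carrier D \<union> pseudo_Cauchy_limits D G v D' v')"


text \<open>
  Existence of algebraic structures cannot quantify over types. The structures are therefore
  built on subsets of one fixed type with continuum many elements, which serves only as a supply
  of elements; the operations are arbitrary.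
\<close>

type_synonym universe = "nat set"

end

(*
  The limit of a pseudo-Cauchy sequence is far from unique. Take D = Q((t)) and D' = Q((t))((s))
  with the rank two valuation into Z x Z, ordered lexicographically with s-order first. The
  sequence of the powers of t converges to 0 in D, but every element whose s-order is positive is
  closer to 0 than all these powers and hence is a limit as well. Each element of D' is a quotient
  of two such limits, whereas the value (1, 0) of s is not taken on D.
*)

theory Submission
  imports
    Defs
    "HOL-Computational_Algebra.Formal_Laurent_Series"
    "HOL-Library.Countable"
    "HOL-Library.Product_Lexorder"
    "HOL-Library.Product_Plus"
begin

section \<open>Subfields of a field carried over to another type along an injection\<close>

definition subfield_set :: "'b::field set \<Rightarrow> bool"
  where "subfield_set S \<longleftrightarrow> 0 \<in> S \<and> 1 \<in> S \<and>
    (\<forall>a\<in>S. \<forall>b\<in>S. a + b \<in> S \<and> a * b \<in> S) \<and> (\<forall>a\<in>S. - a \<in> S \<and> inverse a \<in> S)"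

text \<open>The injection is inverted on all of \<open>UNIV\<close> and not just on
  \<open>S\<close>, so that the operations do not depend on \<open>S\<close>. Passing to a subfield
  is then a mere change of carrier, as \<open>sub_div_ring\<close> and
  \<open>valuation_extension\<close> require.\<close>

definition image_ring :: "('b::field \<Rightarrow> 'c) \<Rightarrow> 'b set \<Rightarrow> 'c ring"
  where "image_ring \<phi> S =
    \<lparr>carrier = \<phi> ` S, monoid.mult = (\<lambda>x y. \<phi> (inv_into UNIV \<phi> x * inv_into UNIV \<phi> y)), one = \<phi> 1,
     zero = \<phi> 0, add = (\<lambda>x y. \<phi> (inv_into UNIV \<phi> x + inv_into UNIV \<phi> y))\<rparr>"

lemma image_ring_simps [simp]:
  "carrier (image_ring \<phi> S) = \<phi> ` S"
  "\<one>\<^bsub>image_ring \<phi> S\<^esub> = \<phi> 1" "\<zero>\<^bsub>image_ring \<phi> S\<^esub> = \<phi> 0"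
  "(image_ring \<phi> S)\<lparr>carrier := \<phi> ` T\<rparr> = image_ring \<phi> T"
  by (simp_all add: image_ring_def)

lemma image_ring_mult [simp]: "inj \<phi> \<Longrightarrow> \<phi> a \<otimes>\<^bsub>image_ring \<phi> S\<^esub> \<phi> b = \<phi> (a * b)"
  and image_ring_add [simp]: "inj \<phi> \<Longrightarrow> \<phi> a \<oplus>\<^bsub>image_ring \<phi> S\<^esub> \<phi> b = \<phi> (a + b)"
  by (simp_all add: image_ring_def)

lemma ring_image_ring:
  assumes \<phi>: "inj \<phi>" and S: "subfield_set S"
  shows "ring (image_ring \<phi> S)"
proof (rule ringI)
  show "abelian_group (image_ring \<phi> S)"
  proof (rule abelian_groupI)
    fix x assume "x \<in> carrier (image_ring \<phi> S)"
    then obtain a where "x = \<phi> a" "a \<in> S" by auto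
    then show "\<exists>y\<in>carrier (image_ring \<phi> S). y \<oplus>\<^bsub>image_ring \<phi> S\<^esub> x = \<zero>\<^bsub>image_ring \<phi> S\<^esub>"
      using \<phi> S by (intro bexI[of _ "\<phi> (- a)"]) (auto simp: subfield_set_def)
  qed (use \<phi> S in \<open>auto simp: subfield_set_def add_ac\<close>)
  show "monoid (image_ring \<phi> S)"
    by (rule monoidI) (use \<phi> S in \<open>auto simp: subfield_set_def mult_ac\<close>)
qed (use \<phi> S in \<open>auto simp: algebra_simps\<close>)

lemma Units_image_ring:
  assumes \<phi>: "inj \<phi>" and S: "subfield_set S"
  shows "Units (image_ring \<phi> S) = carrier (image_ring \<phi> S) - {\<zero>\<^bsub>image_ring \<phi> S\<^esub>}"
proof (intro equalityI subsetI)
  fix x assume "x \<in> Units (image_ring \<phi> S)"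
  then obtain a b where "x = \<phi> a" "a \<in> S" "\<phi> b \<otimes>\<^bsub>image_ring \<phi> S\<^esub> \<phi> a = \<phi> 1"
    by (auto simp: Units_def)
  then show "x \<in> carrier (image_ring \<phi> S) - {\<zero>\<^bsub>image_ring \<phi> S\<^esub>}"
    using \<phi> by (auto simp: inj_eq)
next
  fix x assume "x \<in> carrier (image_ring \<phi> S) - {\<zero>\<^bsub>image_ring \<phi> S\<^esub>}"
  then obtain a where "x = \<phi> a" "a \<in> S" "a \<noteq> 0" by auto
  then show "x \<in> Units (image_ring \<phi> S)"
    using \<phi> S by (auto simp: Units_def subfield_set_def intro!: bexI[of _ "inverse a"])
qed

lemma div_ring_image_ring:
  assumes "inj \<phi>" "subfield_set S"
  shows "div_ring (image_ring \<phi> S)"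
  using ring_image_ring[OF assms] Units_image_ring[OF assms] assms(1)
  by (auto simp: div_ring_def div_ring_axioms_def inj_eq)

lemma image_ring_a_inv:
  assumes "inj \<phi>" "subfield_set S" "a \<in> S"
  shows "\<ominus>\<^bsub>image_ring \<phi> S\<^esub> \<phi> a = \<phi> (- a)"
proof -
  interpret ring "image_ring \<phi> S" by (rule ring_image_ring) fact+
  show ?thesis
    using assms by (intro minus_equality) (auto simp: subfield_set_def)
qed

lemma image_ring_minus:
  assumes "inj \<phi>" "subfield_set S" "b \<in> S"
  shows "\<phi> a \<ominus>\<^bsub>image_ring \<phi> S\<^esub> \<phi> b = \<phi> (a - b)"
  using assms by (simp add: a_minus_def image_ring_a_inv)

lemma sub_div_ring_image_ring:
  assumes \<phi>: "inj \<phi>" and S: "subfield_set S" and T: "subfield_set T" and "T \<subseteq> S"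
  shows "sub_div_ring (\<phi> ` T) (image_ring \<phi> S)"
proof -
  interpret ring "image_ring \<phi> S" by (rule ring_image_ring) fact+
  have "subring (\<phi> ` T) (image_ring \<phi> S)"
    using assms by (intro subringI) (auto simp: image_ring_a_inv subset_iff subfield_set_def)
  then show ?thesis
    using div_ring_image_ring[OF \<phi> T] by (simp add: sub_div_ring_def)
qed

text \<open>Used for an arbitrary member of the family that defines the generated division ring. An
  inverse found inside \<open>K\<close> is also one in the ambient field, where inverses are unique.
  For \<open>a = 0\<close> the convention \<open>inverse 0 = 0\<close> settles the claim.\<close>

lemma sub_div_ring_inverse:
  assumes \<phi>: "inj \<phi>" and K: "sub_div_ring K (image_ring \<phi> S)" and "\<phi> a \<in> K"
  shows "\<phi> (inverse a) \<in> K"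
proof (cases "a = 0")
  case False
  let ?K = "(image_ring \<phi> S)\<lparr>carrier := K\<rparr>"
  have "K \<subseteq> \<phi> ` S"
    using K subringE(1) by (fastforce simp: sub_div_ring_def)
  have "Units ?K = K - {\<phi> 0}"
    using K div_ring.Units_eq[of ?K] by (simp add: sub_div_ring_def)
  then have "\<phi> a \<in> Units ?K"
    using False \<phi> assms(3) by (auto simp: inj_eq)
  then obtain y where y: "y \<in> K" "y \<otimes>\<^bsub>image_ring \<phi> S\<^esub> \<phi> a = \<phi> 1"
    by (auto simp: Units_def)
  then obtain b where "y = \<phi> b"
    using \<open>K \<subseteq> \<phi> ` S\<close> by auto
  then have "b = inverse a"
    using y \<phi> False by (simp add: inj_eq field_simps)
  then show ?thesis
    using y \<open>y = \<phi> b\<close> by simp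
qed (use assms in simp)

section \<open>Ordered groups and valuations carried over in the same way\<close>

definition image_group :: "('b::linordered_ab_group_add \<Rightarrow> 'c) \<Rightarrow> 'b set \<Rightarrow> 'c ordered_group"
  where "image_group \<psi> H =
    \<lparr>carrier = \<psi> ` H, monoid.mult = (\<lambda>x y. \<psi> (inv_into UNIV \<psi> x + inv_into UNIV \<psi> y)), one = \<psi> 0,
     gle = (\<lambda>x y. inv_into UNIV \<psi> x \<le> inv_into UNIV \<psi> y)\<rparr>"

lemma image_group_simps [simp]:
  "carrier (image_group \<psi> H) = \<psi> ` H"
  "\<one>\<^bsub>image_group \<psi> H\<^esub> = \<psi> 0"
  "(image_group \<psi> H)\<lparr>carrier := \<psi> ` T\<rparr> = image_group \<psi> T"
  by (simp_all add: image_group_def)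

lemma image_group_mult [simp]: "inj \<psi> \<Longrightarrow> \<psi> a \<otimes>\<^bsub>image_group \<psi> H\<^esub> \<psi> b = \<psi> (a + b)"
  and image_group_gle [simp]: "inj \<psi> \<Longrightarrow> \<psi> a \<preceq>\<^bsub>image_group \<psi> H\<^esub> \<psi> b \<longleftrightarrow> a \<le> b"
  by (simp_all add: image_group_def)

definition additive_subgroup_set :: "'b::ab_group_add set \<Rightarrow> bool"
  where "additive_subgroup_set H \<longleftrightarrow> 0 \<in> H \<and> (\<forall>a\<in>H. \<forall>b\<in>H. a + b \<in> H) \<and> (\<forall>a\<in>H. - a \<in> H)"

lemma group_image_group:
  assumes "inj \<psi>" "additive_subgroup_set H"
  shows "group (image_group \<psi> H)"
proof (rule groupI)
  fix x assume "x \<in> carrier (image_group \<psi> H)"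
  then obtain a where "x = \<psi> a" "a \<in> H" by auto
  then show "\<exists>y\<in>carrier (image_group \<psi> H). y \<otimes>\<^bsub>image_group \<psi> H\<^esub> x = \<one>\<^bsub>image_group \<psi> H\<^esub>"
    using assms by (intro bexI[of _ "\<psi> (- a)"]) (auto simp: additive_subgroup_set_def)
qed (use assms in \<open>auto simp: additive_subgroup_set_def add_ac\<close>)

lemma ordered_group_image_group:
  assumes \<psi>: "inj \<psi>" and H: "additive_subgroup_set H"
  shows "ordered_group (image_group \<psi> H)"
proof -
  interpret group "image_group \<psi> H" by (rule group_image_group) fact+
  show ?thesis
  proof
    show "linear_order_on (carrier (image_group \<psi> H))
      {(x, y). x \<in> carrier (image_group \<psi> H) \<and> y \<in> carrier (image_group \<psi> H) \<and>
        x \<preceq>\<^bsub>image_group \<psi> H\<^esub> y}"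
      using \<psi> by (auto simp: linear_order_on_def partial_order_on_def preorder_on_def
          refl_on_def trans_def antisym_def total_on_def)
  qed (use \<psi> in auto)
qed

lemma ordered_subgroup_image_group:
  assumes \<psi>: "inj \<psi>" and H: "additive_subgroup_set H" and T: "additive_subgroup_set T"
    and "T \<subseteq> H"
  shows "ordered_subgroup (image_group \<psi> T) (image_group \<psi> H)"
proof -
  interpret group "image_group \<psi> H" by (rule group_image_group) fact+
  have "inv\<^bsub>image_group \<psi> H\<^esub> \<psi> a = \<psi> (- a)" if "a \<in> H" for a
    using that \<psi> H by (intro inv_equality) (auto simp: additive_subgroup_set_def)
  then have "subgroup (\<psi> ` T) (image_group \<psi> H)"
    using assms by (intro subgroupI) (auto simp: additive_subgroup_set_def subset_iff)
  then show ?thesis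
    by (simp add: ordered_subgroup_def)
qed

text \<open>The value of \<open>w\<close> at 0 is arbitrary and gets overridden by
  \<open>Infinity\<close>. Neither a subfield nor a subgroup enters, so one and the same function
  serves as the valuation on both fields.\<close>

definition image_val ::
    "('b::field \<Rightarrow> 'c) \<Rightarrow> ('g \<Rightarrow> 'd) \<Rightarrow> ('b \<Rightarrow> 'g) \<Rightarrow> 'c \<Rightarrow> 'd with_infinity"
  where "image_val \<phi> \<psi> w x = (if inv_into UNIV \<phi> x = 0 then Infinity else Val (\<psi> (w (inv_into UNIV \<phi> x))))"

lemma image_val_image [simp]:
  "inj \<phi> \<Longrightarrow> image_val \<phi> \<psi> w (\<phi> a) = (if a = 0 then Infinity else Val (\<psi> (w a)))"
  by (simp add: image_val_def)

lemma valuation_image_val: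
  fixes w :: "'b::field \<Rightarrow> 'g::linordered_ab_group_add"
  assumes \<phi>: "inj \<phi>" and \<psi>: "inj \<psi>" and S: "subfield_set S" and H: "additive_subgroup_set H"
    and wH: "\<And>a. a \<in> S \<Longrightarrow> a \<noteq> 0 \<Longrightarrow> w a \<in> H"
    and w_mult: "\<And>a b. a \<noteq> 0 \<Longrightarrow> b \<noteq> 0 \<Longrightarrow> w (a * b) = w a + w b"
    and w_add: "\<And>a b. a \<noteq> 0 \<Longrightarrow> b \<noteq> 0 \<Longrightarrow> a + b \<noteq> 0 \<Longrightarrow> min (w a) (w b) \<le> w (a + b)"
  shows "valuation (image_ring \<phi> S) (image_group \<psi> H) (image_val \<phi> \<psi> w)"
proof -
  interpret div_ring "image_ring \<phi> S" by (rule div_ring_image_ring) fact+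
  interpret G: ordered_group "image_group \<psi> H" by (rule ordered_group_image_group) fact+
  show ?thesis
  proof
    fix x y assume "x \<in> carrier (image_ring \<phi> S)" "y \<in> carrier (image_ring \<phi> S)"
    then obtain a b where ab: "x = \<phi> a" "y = \<phi> b" by auto
    then show "val_le (image_group \<psi> H)
        (val_min (image_group \<psi> H) (image_val \<phi> \<psi> w x) (image_val \<phi> \<psi> w y))
        (image_val \<phi> \<psi> w (x \<oplus>\<^bsub>image_ring \<phi> S\<^esub> y))"
      using \<phi> \<psi> w_add[of a b] by (auto simp: val_min_def min_def)
  qed (use \<phi> \<psi> S wH w_mult in \<open>auto simp: inj_eq split: if_splits\<close>)
qed

section \<open>The lexicographic valuation of rank two on iterated Laurent series\<close>

instance prod :: (linordered_ab_group_add, linordered_ab_group_add) linordered_ab_group_add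
  by standard (auto simp: less_eq_prod_def)

text \<open>The outer series variable is s, the variable of the coefficients is t: the s-order comes
  first, then the t-order of the leading coefficient in s.\<close>

definition fls_lex_val :: "'a::zero fls fls \<Rightarrow> int \<times> int"
  where "fls_lex_val f = (fls_subdegree f, fls_subdegree (fls_nth f (fls_subdegree f)))"

text \<open>Leading coefficients in s multiply, as \<open>'a fls\<close> has no zero
  divisors.\<close>

lemma fls_lex_val_mult:
  fixes f g :: "'a::field fls fls"
  assumes "f \<noteq> 0" "g \<noteq> 0"
  shows "fls_lex_val (f * g) = fls_lex_val f + fls_lex_val g"
  using assms by (simp add: fls_lex_val_def)

text \<open>If the s-orders differ, the sum has the leading term of the summand of smaller order. If
  they agree and the leading coefficients cancel, the s-order grows and the first component decides.
  Otherwise the leading coefficients add up, and the inequality is that for t-orders.\<close>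

lemma fls_lex_val_add:
  fixes f g :: "'a::field fls fls"
  assumes "f \<noteq> 0" "g \<noteq> 0" "f + g \<noteq> 0"
  shows "min (fls_lex_val f) (fls_lex_val g) \<le> fls_lex_val (f + g)"
proof -
  consider "fls_subdegree f < fls_subdegree g" | "fls_subdegree g < fls_subdegree f"
    | "fls_subdegree f = fls_subdegree g" "fls_subdegree f < fls_subdegree (f + g)"
    | "fls_subdegree f = fls_subdegree g" "fls_subdegree f = fls_subdegree (f + g)"
    using fls_plus_subdegree[OF assms(3)] by linarith
  then show ?thesis
  proof cases
    case 4
    let ?n = "fls_subdegree f"
    \<comment> \<open>In this case the sum is the leading coefficient of
      \<open>f + g\<close>.\<close>
    have "fls_nth f ?n + fls_nth g ?n \<noteq> 0"
      using 4 assms(3) by (metis fls_plus_nth nth_fls_subdegree_nonzero)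
    then show ?thesis
      using 4 fls_plus_subdegree[of "fls_nth f ?n" "fls_nth g ?n"]
      by (auto simp: fls_lex_val_def min_def)
  qed (use assms fls_subdegree_add_eq1[of f g] fls_subdegree_add_eq2[of g f] in
      \<open>auto simp: fls_lex_val_def min_def\<close>)
qed

lemma fls_lex_val_const [simp]: "fls_lex_val (fls_const c) = (0, fls_subdegree c)"
  by (simp add: fls_lex_val_def)

lemma subfield_set_range_fls_const: "subfield_set (range (fls_const :: 'a::field \<Rightarrow> _))"
proof -
  have "inverse (fls_const a) = fls_const (inverse a)" for a :: 'a
    by (simp add: fls_inverse_const)
  then show ?thesis
    by (auto simp: subfield_set_def fls_plus_const simp flip: fls_const_uminus
        intro: range_eqI[of _ _ 0] range_eqI[of _ _ 1])
qed

section \<open>Coding of elements and indices by sets of natural numbers\<close>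

text \<open>A function is determined by its graph, and between countable types the graph can be
  coded as a set of naturals. Thus an uncountable field of series fits into
  \<open>universe\<close>.\<close>

lemma inj_nat_set_if_countable_graph:
  fixes F :: "'b \<Rightarrow> 'i::countable \<Rightarrow> 'v::countable"
  assumes "inj F"
  shows "inj (\<lambda>x. to_nat ` {(i, F x i) |i. True})"
proof (rule injI)
  fix x y assume "to_nat ` {(i, F x i) |i. True} = to_nat ` {(i, F y i) |i. True}"
  then have "{(i, F x i) |i. True} = {(i, F y i) |i. True}"
    by (simp add: inj_image_eq_iff)
  then have "F x = F y"
    by (auto simp: set_eq_iff fun_eq_iff)
  then show "x = y"
    using assms by (simp add: inj_eq)
qed

text \<open>The order type \<open>\<omega>\<close>, realised on singletons because index sets live in the universe.\<close>

definition nat_order :: "nat set rel"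
  where "nat_order = {({m}, {n}) |m n. m \<le> n}"

lemma nat_order_iff [simp]: "({m}, {n}) \<in> nat_order \<longleftrightarrow> m \<le> n"
  by (simp add: nat_order_def)

lemma Field_nat_order: "Field nat_order = range (\<lambda>n. {n})"
  by (auto simp: nat_order_def Field_def)

lemma Well_order_nat_order: "Well_order nat_order"
proof -
  \<comment> \<open>The intersection with pairs of singletons is there because
    \<open>the_elem\<close> is unspecified on other sets.\<close>
  have "nat_order - Id = inv_image less_than the_elem \<inter> (range (\<lambda>n. {n}) \<times> range (\<lambda>n. {n}))"
    by (auto simp: nat_order_def)
  then have "wf (nat_order - Id)"
    by (simp add: wf_Int1)
  then show ?thesis
    by (auto simp: well_order_on_def linear_order_on_def partial_order_on_def preorder_on_def
        refl_on_def trans_def antisym_def total_on_def Field_nat_order) (auto simp: nat_order_def)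
qed

lemma limit_ordinal_nat_order: "limit_ordinal nat_order"
proof -
  have "({n}, {Suc n}) \<in> nat_order - Id" for n
    by (auto simp: nat_order_def)
  then show ?thesis
    using Well_order_nat_order unfolding limit_ordinal_def Field_nat_order by blast
qed

lemma suc_nat_order: "wo_rel.suc nat_order {{n}} = {Suc n}"
proof -
  interpret wo_rel nat_order
    by (simp add: wo_rel_def Well_order_nat_order)
  have "AboveS {{n}} = {{m} |m. n < m}"
    by (auto simp: AboveS_def Field_nat_order)
  then show ?thesis
    unfolding suc_def by (intro equals_minim[symmetric]) (auto simp: Field_nat_order)
qed

section \<open>Limits of the sequence of powers of t\<close>

text \<open>Subtracting t^n from an element of positive s-order leaves -t^n as the leading
  coefficient in s. The value is therefore (0, n), which is also the value of t^(n+1) - t^n.\<close>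

lemma limit_of_fls_X_powers:
  fixes \<phi> :: "'a::field fls fls \<Rightarrow> universe" and \<psi> :: "int \<times> int \<Rightarrow> universe"
  assumes \<phi>: "inj \<phi>" and \<psi>: "inj \<psi>" and f: "f = 0 \<or> 0 < fls_subdegree f"
  shows "\<phi> f \<in> pseudo_Cauchy_limits
    (image_ring \<phi> (range fls_const)) (image_group \<psi> ({0} \<times> UNIV)) (image_val \<phi> \<psi> fls_lex_val)
    (image_ring \<phi> UNIV) (image_val \<phi> \<psi> fls_lex_val)"
    (is "_ \<in> pseudo_Cauchy_limits ?D ?G ?v ?D' ?v")
proof -
  \<comment> \<open>Here \<open>fls_X\<close> is t, since it stands below
    \<open>fls_const\<close>.\<close>
  let ?c = "\<lambda>n. fls_const (fls_X ^ n) :: 'a fls fls"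
  let ?s = "\<lambda>i. \<phi> (?c (the_elem i))"
  have const: "subfield_set (range fls_const :: 'a fls fls set)"
    by (rule subfield_set_range_fls_const)
  have UNIV: "subfield_set (UNIV :: 'a fls fls set)"
    by (simp add: subfield_set_def)
  have diff: "fls_subdegree (fls_X ^ m - fls_X ^ n :: 'a fls) = int m"
      "(fls_X ^ m - fls_X ^ n :: 'a fls) \<noteq> 0" if "m < n" for m n
  proof -
    have "fls_nth (fls_X ^ m - fls_X ^ n :: 'a fls) (int m) \<noteq> 0"
      using that by (simp add: fls_X_power_nth)
    then show "(fls_X ^ m - fls_X ^ n :: 'a fls) \<noteq> 0" by (rule contrapos_nn) (simp only: fls_zero_nth)
    show "fls_subdegree (fls_X ^ m - fls_X ^ n :: 'a fls) = int m"
      using that by (subst fls_subdegree_diff_eq1) auto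
  qed
  have v_diff: "?v (\<phi> (?c m - ?c n)) = Val (\<psi> (0, int m))" if "m < n" for m n
    using diff[OF that] \<phi> by (simp add: fls_minus_const)
  have v_limit: "?v (\<phi> (f - ?c n)) = Val (\<psi> (0, int n))" for n
  \<comment> \<open>Zero is treated apart because \<open>fls_subdegree 0 = 0\<close>, so that it
    does not count as having positive s-order.\<close>
  proof (cases "f = 0")
    case True
    have "- ?c n = fls_const (- (fls_X ^ n))" by simp
    then show ?thesis
      using True \<phi> by (simp del: fls_const_uminus)
  next
    case False
    then have pos: "0 < fls_subdegree f" using f by simp
    then have nth: "fls_nth (f - ?c n) 0 = - (fls_X ^ n)" by simp
    have sub: "fls_subdegree (f - ?c n) = 0"
      using False pos by (subst fls_subdegree_diff_eq2) auto
    have "f - ?c n \<noteq> 0" using nth by auto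
    then show ?thesis
      using \<phi> sub nth by (simp add: fls_lex_val_def)
  qed
  have "?v (?s {m} \<ominus>\<^bsub>?D\<^esub> ?s {n}) = Val (\<psi> (0, int m))" if "m < n" for m n
    using v_diff[OF that] by (simp only: image_ring_minus[OF \<phi> const rangeI] the_elem_eq)
  then have less: "val_less ?G (?v (?s {k} \<ominus>\<^bsub>?D\<^esub> ?s {m})) (?v (?s {m} \<ominus>\<^bsub>?D\<^esub> ?s {n}))"
    if "k < m" "m < n" for k m n
    using that \<psi> by (simp add: val_less_def inj_eq less_eq_prod_def)
  have "pseudo_Cauchy_from ?D ?G ?v nat_order ?s {0}"
    unfolding pseudo_Cauchy_from_def
  proof (intro conjI allI impI)
    fix \<sigma> \<rho> \<tau>
    assume "({0}, \<sigma>) \<in> nat_order \<and> (\<sigma>, \<rho>) \<in> nat_order - Id \<and> (\<rho>, \<tau>) \<in> nat_order - Id"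
    then obtain k m n where "\<sigma> = {k}" "\<rho> = {m}" "\<tau> = {n}"
        "k \<le> m" "m \<le> n" "k \<noteq> m" "m \<noteq> n"
      by (auto simp: nat_order_def)
    then show "val_less ?G (?v (?s \<sigma> \<ominus>\<^bsub>?D\<^esub> ?s \<rho>)) (?v (?s \<rho> \<ominus>\<^bsub>?D\<^esub> ?s \<tau>))"
      using less[of k m n] by simp
  qed (auto simp: limit_ordinal_nat_order Field_nat_order)
  moreover have "limit_from ?D' ?v nat_order ?s {0} (\<phi> f)"
    unfolding limit_from_def
  proof (intro conjI allI impI)
    fix \<sigma> assume "({0}, \<sigma>) \<in> nat_order"
    then obtain n where \<sigma>: "\<sigma> = {n}" by (auto simp: nat_order_def)
    \<comment> \<open>The limit condition subtracts the earlier term from the later one, the reverse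
      of \<open>diff\<close>; the order of a difference is symmetric.\<close>
    have "?v (\<phi> (?c (Suc n) - ?c n)) = Val (\<psi> (0, int n))"
      using diff[of n "Suc n"] \<phi>
      by (simp add: fls_minus_const fls_subdegree_minus_sym del: power_Suc)
    then show "?v (\<phi> f \<ominus>\<^bsub>?D'\<^esub> ?s \<sigma>) = ?v (?s (wo_rel.suc nat_order {\<sigma>}) \<ominus>\<^bsub>?D'\<^esub> ?s \<sigma>)"
      using \<phi> UNIV v_limit[of n] by (simp add: \<sigma> suc_nat_order image_ring_minus del: power_Suc)
  qed simp
  ultimately show ?thesis
    unfolding pseudo_Cauchy_limits_def by blast
qed

section \<open>The extension of Q((t)) by Q((t))((s))\<close>

theorem corollary5p3:
  shows "\<exists>(D :: universe ring) (D' :: universe ring)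
           (G :: universe ordered_group) (G' :: universe ordered_group)
           (v :: universe \<Rightarrow> universe with_infinity) (v' :: universe \<Rightarrow> universe with_infinity).
         div_ring D \<and> div_ring D' \<and>
         valuation_extension D G v D' G' v' \<and>
         extension_by_limits D G v D' v' \<and>
         \<not> immediate_extension D G v D' G' v'"
proof -
  \<comment> \<open>A double series is coded through its coefficient function on pairs of integers;
    rational coefficients keep the graph inside a countable type.\<close>
  define \<phi> :: "rat fls fls \<Rightarrow> universe"
    where "\<phi> = (\<lambda>f. to_nat ` {(i, (\<lambda>(j, k). fls_nth (fls_nth f j) k) i) |i. True})"
  define \<psi> :: "int \<times> int \<Rightarrow> universe" where "\<psi> = (\<lambda>p. {to_nat p})"
  \<comment> \<open>The copy of Q((t)) inside Q((t))((s)): the series that are constant in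
    s.\<close>
  define K :: "rat fls fls set" where "K = range fls_const"
  define v where "v = image_val \<phi> \<psi> fls_lex_val"
  let ?D = "image_ring \<phi> K" and ?D' = "image_ring \<phi> UNIV"
  let ?G = "image_group \<psi> ({0} \<times> UNIV)" and ?G' = "image_group \<psi> UNIV"
  have \<phi>: "inj \<phi>"
    unfolding \<phi>_def
    by (rule inj_nat_set_if_countable_graph) (auto intro!: injI fls_eqI simp: fun_eq_iff)
  have \<psi>: "inj \<psi>"
    by (auto simp: \<psi>_def inj_def)
  have K: "subfield_set K" and UNIV: "subfield_set (UNIV :: rat fls fls set)"
    by (simp_all add: K_def subfield_set_range_fls_const) (simp add: subfield_set_def)
  have H: "additive_subgroup_set ({0} \<times> UNIV :: (int \<times> int) set)"
      "additive_subgroup_set (UNIV :: (int \<times> int) set)"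
    by (auto simp: additive_subgroup_set_def zero_prod_def)
  \<comment> \<open>On \<open>K\<close> the s-order vanishes, so the values lie in
    \<open>{0} \<times> UNIV\<close>.\<close>
  have "valuation ?D ?G v" "valuation ?D' ?G' v"
    unfolding v_def using \<phi> \<psi> K UNIV H
    by (auto simp: K_def fls_lex_val_mult fls_lex_val_add intro!: valuation_image_val)
  then have ext: "valuation_extension ?D ?G v ?D' ?G' v"
    using sub_div_ring_image_ring[OF \<phi> UNIV K] ordered_subgroup_image_group[OF \<psi> H(2,1)]
    by (simp add: valuation_extension_def)
  \<comment> \<open>Every sub division ring that contains the limits is the whole of
    \<open>?D'\<close>.\<close>
  have "\<phi> f \<in> L" if L: "sub_div_ring L ?D'" "pseudo_Cauchy_limits ?D ?G v ?D' v \<subseteq> L" for f L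
  proof -
    have pos: "\<phi> g \<in> L" if "g = 0 \<or> 0 < fls_subdegree g" for g
      using limit_of_fls_X_powers[OF \<phi> \<psi> that] L by (auto simp: v_def K_def)
    \<comment> \<open>For positive s-order \<open>f\<close> is a limit, for negative s-order its
      inverse is one. For s-order 0 both s and s * f are limits, and \<open>f\<close> is their
      quotient.\<close>
    consider "f = 0 \<or> 0 < fls_subdegree f" | "f \<noteq> 0" "fls_subdegree f < 0"
      | "f \<noteq> 0" "fls_subdegree f = 0" by linarith
    then show ?thesis
    proof cases
      case 2
      then have "\<phi> (inverse f) \<in> L" by (intro pos) simp
      from sub_div_ring_inverse[OF \<phi> L(1) this] show ?thesis by simp
    next
      case 3
      \<comment> \<open>At this type \<open>fls_X\<close> is s, in contrast to the sequence
        above.\<close>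
      have "\<phi> (fls_X * f) \<in> L" "\<phi> (inverse fls_X) \<in> L"
        using 3 pos[of fls_X] by (auto intro!: pos sub_div_ring_inverse[OF \<phi> L(1)])
      then have "\<phi> (inverse fls_X) \<otimes>\<^bsub>?D'\<^esub> \<phi> (fls_X * f) \<in> L"
        using L(1) subringE(6)[of L ?D'] unfolding sub_div_ring_def by blast
      moreover have "inverse fls_X * (fls_X * f) = f"
        by (simp flip: mult.assoc)
      ultimately show ?thesis using \<phi> by simp
    qed (rule pos)
  qed
  then have "carrier ?D' \<subseteq> div_ring_generated ?D' (carrier ?D \<union> pseudo_Cauchy_limits ?D ?G v ?D' v)"
    by (auto simp: div_ring_generated_def hull_def)
  \<comment> \<open>Conversely, the carrier of \<open>?D'\<close> is itself one of the sub division
    rings intersected in the hull.\<close>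
  moreover have "div_ring_generated ?D' (carrier ?D \<union> pseudo_Cauchy_limits ?D ?G v ?D' v) \<subseteq> carrier ?D'"
    unfolding div_ring_generated_def
    using sub_div_ring_image_ring[OF \<phi> UNIV UNIV]
    by (intro hull_minimal) (auto simp: pseudo_Cauchy_limits_def limit_from_def)
  ultimately have "extension_by_limits ?D ?G v ?D' v"
    unfolding extension_by_limits_def by (rule equalityI)
  moreover have "value_group ?D ?G v \<noteq> value_group ?D' ?G' v"
  proof -
    \<comment> \<open>The witness is s, whose leading coefficient 1 has t-order 0.\<close>
    have "\<psi> (1, 0) \<in> value_group ?D' ?G' v"
      using \<phi> \<psi> by (auto simp: value_group_def v_def fls_lex_val_def intro!: exI[of _ "fls_X"])
    \<comment> \<open>A value group lies in the carrier of its ordered group, and in that of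
      \<open>?G\<close> the first component is always 0.\<close>
    moreover have "\<psi> (1, 0) \<notin> value_group ?D ?G v"
      using \<psi> by (auto simp: value_group_def inj_eq)
    ultimately show ?thesis by metis
  qed
  ultimately show ?thesis
    using ext div_ring_image_ring[OF \<phi> K] div_ring_image_ring[OF \<phi> UNIV]
    unfolding immediate_extension_def by blast
qed

end
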